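(* Let $U=U_1\times\cdots\times U_m$ be a Cartesian product of nonempty finite sets. If $S\subseteq U$ is ample, then for any factor $U_i$ the following sets are ample: (1) the sectors $S(a)$ and the cosectors $S^c(a)$ for all $a\in U_i$; (2) the boundaries $\partial S(a)$ of all sectors $S(a)$, $a\in U_i$; (3) the neighborhoods $N(S(a))$ of all sectors $S(a)$, $a\in U_i$; (4) the extended sectors $S^+(a)$ for all $a\in U_i$; (5) the carrier $C_i(S)$.
   Context: Two tuples of $U$ are adjacent (neighbors) if they differ in exactly one coordinate. For $a\in U_i$: the sector $S(a)$ is the set of all $u\in S$ with $u_i=a$; the boundary $\partial S(a)$ is the set of all $u\in S(a)$ adjacent to some $v\in S$ with $v_i\ne a$; the cosector is $S^c(a)=S\setminus S(a)$; the neighborhood $N(S(a))$ is the set of all $v\in S^c(a)$ having a neighbor in $S(a)$; the extended sector is $S^+(a)=S(a)\cup N(S(a))$; the $i$-carrier is $C_i(S)=\bigcup_{a\in U_i}\partial S(a)$. A generalized partition of $U$ is a tuple $\Lambda=(\alpha_1,\dots,\alpha_m)$ with $\alpha_i$ a partition of $U_i$ into nonempty blocks; it defines a partition of $U$ into the boxes $P^1\times\cdots\times P^m$, $P^i\in\alpha_i$, and the minor-subproduct $M(\Lambda)=M_1\times\cdots\times M_m$, where $M_i$ is the set of blocks of $\alpha_i$. $M(\Lambda)$ is shattered by $S\subseteq U$ if $S$ meets every box of the box-partition. A copy of $M(\Lambda)$ is a set $W_1\times\cdots\times W_m$ where $W_i$ consists of exactly one element from each block of $\alpha_i$. $M(\Lambda)$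 is strongly shattered by $S$ if $S$ contains a copy of it. $S$ is ample if every minor-subproduct of $U$ shattered by $S$ is strongly shattered by $S$. *)

theory Defs
  imports "HOL-Library.FuncSet" "HOL-Library.Disjoint_Sets"
begin

text \<open>
  The factors are \<open>U 1, \<dots>, U m\<close>, finite subsets of a common type (no loss for finite sets);
  the product is the set of extensional functions \<open>Pi\<^sub>E {1..m} U\<close>, so that equality of tuples is
  equality of functions. Values of \<open>U\<close>, \<open>\<Lambda>\<close>, \<open>W\<close> at indices outside \<open>{1..m}\<close> are irrelevant.
\<close>

abbreviation product :: "nat \<Rightarrow> (nat \<Rightarrow> 'b set) \<Rightarrow> (nat \<Rightarrow> 'b) set" where
  "product m U \<equiv> Pi\<^sub>E {1..m} U"

definition adjacent :: "nat \<Rightarrow> (nat \<Rightarrow> 'a) \<Rightarrow> (nat \<Rightarrow> 'a) \<Rightarrow> bool" where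
  "adjacent m u v \<longleftrightarrow> (\<exists>!j. j \<in> {1..m} \<and> u j \<noteq> v j)"

definition sector :: "(nat \<Rightarrow> 'a) set \<Rightarrow> nat \<Rightarrow> 'a \<Rightarrow> (nat \<Rightarrow> 'a) set" where
  "sector S i a = {u \<in> S. u i = a}"

definition sector_boundary :: "nat \<Rightarrow> (nat \<Rightarrow> 'a) set \<Rightarrow> nat \<Rightarrow> 'a \<Rightarrow> (nat \<Rightarrow> 'a) set" where
  "sector_boundary m S i a = {u \<in> sector S i a. \<exists>v\<in>S. v i \<noteq> a \<and> adjacent m u v}"

definition cosector :: "(nat \<Rightarrow> 'a) set \<Rightarrow> nat \<Rightarrow> 'a \<Rightarrow> (nat \<Rightarrow> 'a) set" where
  "cosector S i a = S - sector S i a"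

definition neighborhood :: "nat \<Rightarrow> (nat \<Rightarrow> 'a) set \<Rightarrow> nat \<Rightarrow> 'a \<Rightarrow> (nat \<Rightarrow> 'a) set" where
  "neighborhood m S i a = {v \<in> cosector S i a. \<exists>u\<in>sector S i a. adjacent m u v}"

definition extended_sector :: "nat \<Rightarrow> (nat \<Rightarrow> 'a) set \<Rightarrow> nat \<Rightarrow> 'a \<Rightarrow> (nat \<Rightarrow> 'a) set" where
  "extended_sector m S i a = sector S i a \<union> neighborhood m S i a"

definition carrier :: "nat \<Rightarrow> (nat \<Rightarrow> 'a set) \<Rightarrow> (nat \<Rightarrow> 'a) set \<Rightarrow> nat \<Rightarrow> (nat \<Rightarrow> 'a) set" where
  "carrier m U S i = (\<Union>a\<in>U i. sector_boundary m S i a)"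

definition generalized_partition ::
    "nat \<Rightarrow> (nat \<Rightarrow> 'a set) \<Rightarrow> (nat \<Rightarrow> 'a set set) \<Rightarrow> bool" where
  "generalized_partition m U \<Lambda> \<longleftrightarrow> (\<forall>i\<in>{1..m}. partition_on (U i) (\<Lambda> i))"

text \<open>
  The elements of the minor-subproduct are the tuples of blocks \<open>P\<close>; the box belonging to \<open>P\<close> is
  \<open>product m P\<close>. Since \<open>\<Lambda>\<close> is determined on \<open>{1..m}\<close> by its minor-subproduct (when the factors are
  nonempty), shattering is expressed as a property of \<open>\<Lambda>\<close>.
\<close>

definition minor_subproduct :: "nat \<Rightarrow> (nat \<Rightarrow> 'a set set) \<Rightarrow> (nat \<Rightarrow> 'a set) set" where
  "minor_subproduct m \<Lambda> = product m \<Lambda>"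

definition shattered :: "nat \<Rightarrow> (nat \<Rightarrow> 'a set set) \<Rightarrow> (nat \<Rightarrow> 'a) set \<Rightarrow> bool" where
  "shattered m \<Lambda> S \<longleftrightarrow> (\<forall>P\<in>minor_subproduct m \<Lambda>. S \<inter> product m P \<noteq> {})"

definition is_copy :: "nat \<Rightarrow> (nat \<Rightarrow> 'a set set) \<Rightarrow> (nat \<Rightarrow> 'a) set \<Rightarrow> bool" where
  "is_copy m \<Lambda> C \<longleftrightarrow>
     (\<exists>W. C = product m W \<and>
          (\<forall>i\<in>{1..m}. W i \<subseteq> \<Union>(\<Lambda> i) \<and> (\<forall>B\<in>\<Lambda> i. \<exists>!x. x \<in> W i \<inter> B)))"

definition strongly_shattered :: "nat \<Rightarrow> (nat \<Rightarrow> 'a set set) \<Rightarrow> (nat \<Rightarrow> 'a) set \<Rightarrow> bool" where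
  "strongly_shattered m \<Lambda> S \<longleftrightarrow> (\<exists>C. is_copy m \<Lambda> C \<and> C \<subseteq> S)"

definition ample :: "nat \<Rightarrow> (nat \<Rightarrow> 'a set) \<Rightarrow> (nat \<Rightarrow> 'a) set \<Rightarrow> bool" where
  "ample m U S \<longleftrightarrow> S \<subseteq> product m U \<and>
     (\<forall>\<Lambda>. generalized_partition m U \<Lambda> \<and> shattered m \<Lambda> S \<longrightarrow> strongly_shattered m \<Lambda> S)"

end

theory Submission
  imports Defs
begin

text \<open>
  The engine is \<open>ample_split\<close>: if \<open>S\<close> still shatters the partition in which the element \<open>a\<close> of
  \<open>U i\<close> is split off as a block of its own, then ampleness yields a copy of \<open>\<Lambda>\<close> in \<open>S\<close> that avoids
  \<open>a\<close> in coordinate \<open>i\<close> and stays in \<open>S\<close> when its \<open>i\<close>-th coordinate is set to \<open>a\<close>. Cosectors,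
  boundaries, neighborhoods and carriers follow by checking this hypothesis. Removing
  elements of \<open>U i\<close> one after another shows that \<open>{u \<in> S. u i \<notin> F}\<close> is ample, which covers
  sectors; for the extended sector of \<open>a\<close>, take \<open>F = B - {a}\<close> with \<open>B\<close> the block of \<open>a\<close>, so that
  every copy in \<open>{u \<in> S. u i \<notin> F}\<close> is forced to use \<open>a\<close>.
\<close>

section \<open>Shattering and copies in terms of coordinates and choice functions\<close>

lemma shattered_iff:
  assumes "S \<subseteq> product m U"
  shows "shattered m \<Lambda> S \<longleftrightarrow> (\<forall>P\<in>product m \<Lambda>. \<exists>u\<in>S. \<forall>j\<in>{1..m}. u j \<in> P j)"
  using assms unfolding shattered_def minor_subproduct_def
  by (fastforce simp: PiE_iff)

text \<open>A copy is encoded by a function \<open>w\<close> choosing the point \<open>w j B\<close> of the block \<open>B \<in> \<Lambda> j\<close>.\<close>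

definition selects_copy ::
    "nat \<Rightarrow> (nat \<Rightarrow> 'a set set) \<Rightarrow> (nat \<Rightarrow> 'a) set \<Rightarrow> (nat \<Rightarrow> 'a set \<Rightarrow> 'a) \<Rightarrow> bool" where
  "selects_copy m \<Lambda> S w \<longleftrightarrow> (\<forall>j\<in>{1..m}. \<forall>B\<in>\<Lambda> j. w j B \<in> B) \<and>
     (\<forall>P\<in>product m \<Lambda>. (\<lambda>j\<in>{1..m}. w j (P j)) \<in> S)"

lemma selects_copyI:
  assumes "\<And>j B. j \<in> {1..m} \<Longrightarrow> B \<in> \<Lambda> j \<Longrightarrow> w j B \<in> B"
    and "\<And>P. P \<in> product m \<Lambda> \<Longrightarrow> (\<lambda>j\<in>{1..m}. w j (P j)) \<in> S"
  shows "selects_copy m \<Lambda> S w"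
  using assms unfolding selects_copy_def by simp

lemma selects_copyD:
  assumes "selects_copy m \<Lambda> S w"
  shows "j \<in> {1..m} \<Longrightarrow> B \<in> \<Lambda> j \<Longrightarrow> w j B \<in> B"
    and "P \<in> product m \<Lambda> \<Longrightarrow> (\<lambda>j\<in>{1..m}. w j (P j)) \<in> S"
  using assms unfolding selects_copy_def by simp_all

lemma selects_copy_mono:
  assumes "selects_copy m \<Lambda> S w" "S \<subseteq> T"
  shows "selects_copy m \<Lambda> T w"
  using assms unfolding selects_copy_def by blast

lemma strongly_shattered_iff:
  assumes "generalized_partition m U \<Lambda>"
  shows "strongly_shattered m \<Lambda> S \<longleftrightarrow> (\<exists>w. selects_copy m \<Lambda> S w)"
proof
  assume "strongly_shattered m \<Lambda> S"
  then obtain C where "is_copy m \<Lambda> C" "C \<subseteq> S"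
    unfolding strongly_shattered_def by blast
  then obtain W where W: "product m W \<subseteq> S"
    "\<And>j B. j \<in> {1..m} \<Longrightarrow> B \<in> \<Lambda> j \<Longrightarrow> \<exists>!x. x \<in> W j \<inter> B"
    unfolding is_copy_def by (elim exE conjE) simp
  define w where "w j B = (THE x. x \<in> W j \<inter> B)" for j B
  have w: "w j B \<in> W j \<inter> B" if "j \<in> {1..m}" "B \<in> \<Lambda> j" for j B
    unfolding w_def using theI'[OF W(2)[OF that]] .
  have "selects_copy m \<Lambda> S w"
    using w PiE_mem by (intro selects_copyI subsetD[OF W(1)]) fastforce+
  then show "\<exists>w. selects_copy m \<Lambda> S w" by blast
next
  assume "\<exists>w. selects_copy m \<Lambda> S w"
  then obtain w where "selects_copy m \<Lambda> S w" ..
  note w = selects_copyD[OF this]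
  define W where "W j = w j ` \<Lambda> j" for j
  have "x \<in> S" if x: "x \<in> product m W" for x
  proof -
    \<comment> \<open>Every point of \<open>product m W\<close> is selected by some tuple of blocks,
      read off coordinate by coordinate.\<close>
    have "\<forall>j\<in>{1..m}. \<exists>B. B \<in> \<Lambda> j \<and> x j = w j B"
      using x by (auto simp: PiE_iff W_def)
    then obtain P where P: "\<And>j. j \<in> {1..m} \<Longrightarrow> P j \<in> \<Lambda> j \<and> x j = w j (P j)"
      by metis
    then have "(\<lambda>j\<in>{1..m}. w j (restrict P {1..m} j)) \<in> S"
      by (intro w(2)) auto
    moreover have "(\<lambda>j\<in>{1..m}. w j (restrict P {1..m} j)) = x"
      using x P by (auto simp: PiE_iff extensional_def fun_eq_iff)
    ultimately show ?thesis by simp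
  qed
  moreover have "\<exists>!x. x \<in> W j \<inter> B" if "j \<in> {1..m}" "B \<in> \<Lambda> j" for j B
  proof -
    have "C = B" if "C \<in> \<Lambda> j" "w j C \<in> B" for C
      using assms w(1)[OF \<open>j \<in> {1..m}\<close> \<open>C \<in> \<Lambda> j\<close>] that \<open>j \<in> {1..m}\<close> \<open>B \<in> \<Lambda> j\<close>
      unfolding generalized_partition_def partition_on_def disjoint_def by blast
    then show ?thesis
      using w(1) that unfolding W_def by (intro ex1I[of _ "w j B"]) auto
  qed
  ultimately show "strongly_shattered m \<Lambda> S"
    unfolding strongly_shattered_def is_copy_def using w(1)
    by (intro exI[of _ "product m W"] conjI exI[of _ W]) (auto simp: W_def)
qed

lemma ampleI:
  assumes "S \<subseteq> product m U"
    and "\<And>\<Lambda>. \<lbrakk>generalized_partition m U \<Lambda>;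
           \<And>P. P \<in> product m \<Lambda> \<Longrightarrow> \<exists>u\<in>S. \<forall>j\<in>{1..m}. u j \<in> P j\<rbrakk>
      \<Longrightarrow> \<exists>w. selects_copy m \<Lambda> S w"
  shows "ample m U S"
  unfolding ample_def
proof (intro conjI allI impI)
  fix \<Lambda> assume \<Lambda>: "generalized_partition m U \<Lambda> \<and> shattered m \<Lambda> S"
  then have "\<forall>P\<in>product m \<Lambda>. \<exists>u\<in>S. \<forall>j\<in>{1..m}. u j \<in> P j"
    using shattered_iff[OF assms(1)] by blast
  with \<Lambda> show "strongly_shattered m \<Lambda> S"
    unfolding strongly_shattered_iff[OF conjunct1[OF \<Lambda>]] by (intro assms(2)) blast+
qed (fact assms(1))

lemma ampleD:
  assumes "ample m U S" "generalized_partition m U \<Lambda>"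
    and "\<And>P. P \<in> product m \<Lambda> \<Longrightarrow> \<exists>u\<in>S. \<forall>j\<in>{1..m}. u j \<in> P j"
  shows "\<exists>w. selects_copy m \<Lambda> S w"
proof -
  have "S \<subseteq> product m U"
    using assms(1) by (simp add: ample_def)
  then have "shattered m \<Lambda> S"
    using assms(3) by (simp add: shattered_iff)
  then show ?thesis
    using assms(1,2) by (simp add: ample_def flip: strongly_shattered_iff)
qed

section \<open>Splitting one point off a partition of a factor\<close>

lemma partition_on_block_unique:
  assumes "partition_on A Q" "B \<in> Q" "C \<in> Q" "x \<in> B" "x \<in> C"
  shows "B = C"
  using assms unfolding partition_on_def disjoint_def by blast

text \<open>Only a block equal to \<open>{a}\<close> could become empty when \<open>a\<close> is
  removed, and this is excluded by assumption. Blocks without \<open>a\<close> are left as they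
  are.\<close>

lemma partition_on_split_point:
  assumes "partition_on A Q" "a \<in> A" "{a} \<notin> Q"
  shows "partition_on A (insert {a} ((\<lambda>B. B - {a}) ` Q))"
proof (rule partition_onI)
  show "\<Union> (insert {a} ((\<lambda>B. B - {a}) ` Q)) = A"
    using assms unfolding partition_on_def by blast
  show "{} \<notin> insert {a} ((\<lambda>B. B - {a}) ` Q)"
  proof
    assume "{} \<in> insert {a} ((\<lambda>B. B - {a}) ` Q)"
    then obtain B where "B \<in> Q" "{} = B - {a}" by blast
    moreover from this(2) have "B \<subseteq> {a}" by blast
    ultimately show False using assms(1,3) unfolding partition_on_def by (metis subset_singletonD)
  qed
  show "disjnt p q"
    if "p \<in> insert {a} ((\<lambda>B. B - {a}) ` Q)" "q \<in> insert {a} ((\<lambda>B. B - {a}) ` Q)" "p \<noteq> q" for p q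
    using that partition_on_block_unique[OF assms(1)] unfolding disjnt_iff by blast
qed

text \<open>Since the factors are nonempty, every coordinate has some block to fill the remaining
  places.\<close>

lemma product_blocks_through:
  assumes "generalized_partition m U \<Lambda>" "\<And>j. j \<in> {1..m} \<Longrightarrow> U j \<noteq> {}" "i \<in> {1..m}" "B \<in> \<Lambda> i"
  obtains P where "P \<in> product m \<Lambda>" "P i = B"
proof -
  have "\<forall>j\<in>{1..m}. \<exists>C. C \<in> \<Lambda> j"
    using assms(1,2) unfolding generalized_partition_def partition_on_def by blast
  then obtain Q where "\<And>j. j \<in> {1..m} \<Longrightarrow> Q j \<in> \<Lambda> j" by metis
  with assms(3,4) show thesis
    by (intro that[of "restrict (Q(i := B)) {1..m}"]) (auto simp: PiE_iff)
qed

lemma product_upd: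
  assumes "P \<in> product m \<Lambda>" "i \<in> {1..m}" "B \<in> Q"
  shows "P(i := B) \<in> product m (\<Lambda>(i := Q))"
  using assms by (auto simp: PiE_iff extensional_def)

text \<open>The exchange property of a copy: replacing the block in coordinate \<open>i\<close>
  changes the selected point in coordinate \<open>i\<close> only.\<close>

lemma pick_upd:
  assumes "i \<in> {1..m}" "w i B = b"
  shows "(\<lambda>j\<in>{1..m}. w j ((P(i := B)) j)) = (\<lambda>j\<in>{1..m}. w j (P j))(i := b)"
  using assms by (auto simp: fun_eq_iff)

text \<open>\<open>H1\<close> gives points in the boxes with \<open>{a}\<close> in coordinate
  \<open>i\<close>, and \<open>H2\<close> in those with \<open>B - {a}\<close>. In a copy of the
  refined partition, the block \<open>{a}\<close> must contribute \<open>a\<close> itself, so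
  exchanging the \<open>i\<close>-th coordinate for \<open>a\<close> stays inside the copy.\<close>

lemma ample_split:
  assumes nonempty: "\<And>j. j \<in> {1..m} \<Longrightarrow> U j \<noteq> {}"
    and ample: "ample m U S" and part: "generalized_partition m U \<Lambda>"
    and i: "i \<in> {1..m}" and a: "a \<in> U i"
    and H1: "\<And>P. P \<in> product m \<Lambda> \<Longrightarrow> \<exists>u\<in>S. u i = a \<and> (\<forall>j\<in>{1..m}-{i}. u j \<in> P j)"
    and H2: "\<And>P. P \<in> product m \<Lambda> \<Longrightarrow> \<exists>u\<in>S. u i \<noteq> a \<and> (\<forall>j\<in>{1..m}. u j \<in> P j)"
  shows "\<exists>w. selects_copy m \<Lambda> {x \<in> S. x i \<noteq> a \<and> x(i := a) \<in> S} w"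
proof -
  define Q where "Q = insert {a} ((\<lambda>B. B - {a}) ` \<Lambda> i)"
  \<comment> \<open>Otherwise \<open>H2\<close>, applied to a tuple through \<open>{a}\<close>,
    would give a point with \<open>u i \<noteq> a\<close> and \<open>u i \<in> {a}\<close>.\<close>
  have "{a} \<notin> \<Lambda> i"
  proof
    assume "{a} \<in> \<Lambda> i"
    then obtain P where "P \<in> product m \<Lambda>" "P i = {a}"
      using product_blocks_through[OF part nonempty i] by blast
    then show False using H2 i by fastforce
  qed
  then have "partition_on (U i) Q"
    unfolding Q_def using part i a
    by (intro partition_on_split_point) (auto simp: generalized_partition_def)
  then have part': "generalized_partition m U (\<Lambda>(i := Q))"
    using part by (auto simp: generalized_partition_def)
  have "\<exists>u\<in>S. \<forall>j\<in>{1..m}. u j \<in> P j" if P: "P \<in> product m (\<Lambda>(i := Q))" for P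
  proof -
    have Pj: "P j \<in> \<Lambda> j" if "j \<in> {1..m}" "j \<noteq> i" for j
      using PiE_mem[OF P that(1)] that(2) by simp
    have "P i \<in> Q" using PiE_mem[OF P i] by simp
    then consider "P i = {a}" | B where "B \<in> \<Lambda> i" "P i = B - {a}"
      unfolding Q_def by blast
    then show ?thesis
    proof cases
      case 1
      \<comment> \<open>\<open>H1\<close> ignores the block in coordinate \<open>i\<close>, so any
        block of \<open>\<Lambda> i\<close> may stand in for \<open>{a}\<close>.\<close>
      obtain B where "B \<in> \<Lambda> i"
        using part i a unfolding generalized_partition_def partition_on_def by blast
      then have "P(i := B) \<in> product m \<Lambda>"
        using product_upd[OF P i, of B "\<Lambda> i"] by simp
      from H1[OF this] 1 show ?thesis by (metis DiffI fun_upd_other singletonD singletonI)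
    next
      case 2
      then have "P(i := B) \<in> product m \<Lambda>"
        using product_upd[OF P i, of B "\<Lambda> i"] by simp
      from H2[OF this] obtain u where u: "u \<in> S" "u i \<noteq> a"
        "\<And>j. j \<in> {1..m} \<Longrightarrow> u j \<in> (P(i := B)) j" by blast
      have "u j \<in> P j" if "j \<in> {1..m}" for j
        using u(3)[OF that] u(2) 2 by (cases "j = i") auto
      with u(1) show ?thesis by blast
    qed
  qed
  then obtain v where v: "selects_copy m (\<Lambda>(i := Q)) S v"
    using ampleD[OF ample part'] by blast
  \<comment> \<open>Back to \<open>\<Lambda>\<close>: a block \<open>B\<close> of coordinate
    \<open>i\<close> receives the point chosen for its remainder \<open>B - {a}\<close>, hence a
    point other than \<open>a\<close>.\<close>
  define w where "w = v(i := \<lambda>B. v i (B - {a}))"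
  have vQ: "v i B \<in> B" if "B \<in> Q" for B
    using selects_copyD(1)[OF v i, of B] that by simp
  have vi: "v i {a} = a" "\<And>B. B \<in> \<Lambda> i \<Longrightarrow> v i (B - {a}) \<in> B - {a}"
    using vQ[of "{a}"] by (simp add: Q_def) (intro vQ, simp add: Q_def)
  have "selects_copy m \<Lambda> {x \<in> S. x i \<noteq> a \<and> x(i := a) \<in> S} w"
  proof (rule selects_copyI)
    show "w j B \<in> B" if "j \<in> {1..m}" "B \<in> \<Lambda> j" for j B
      using selects_copyD(1)[OF v, of j B] vi(2)[of B] that by (auto simp: w_def)
    fix P assume P: "P \<in> product m \<Lambda>"
    have "P i - {a} \<in> Q" using PiE_mem[OF P i] by (simp add: Q_def)
    then have "(\<lambda>j\<in>{1..m}. v j ((P(i := P i - {a})) j)) \<in> S"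
      by (intro selects_copyD(2)[OF v] product_upd[OF P i])
    moreover have "(\<lambda>j\<in>{1..m}. v j ((P(i := P i - {a})) j)) = (\<lambda>j\<in>{1..m}. w j (P j))"
      by (auto simp: w_def fun_eq_iff)
    ultimately have "(\<lambda>j\<in>{1..m}. w j (P j)) \<in> S" by simp
    have "(\<lambda>j\<in>{1..m}. v j ((P(i := {a})) j)) \<in> S"
      by (intro selects_copyD(2)[OF v] product_upd[OF P i]) (simp add: Q_def)
    moreover have "(\<lambda>j\<in>{1..m}. v j ((P(i := {a})) j)) = (\<lambda>j\<in>{1..m}. w j (P j))(i := a)"
      using i vi(1) by (auto simp: w_def fun_eq_iff)
    ultimately have "(\<lambda>j\<in>{1..m}. w j (P j))(i := a) \<in> S" by simp
    moreover have "w i (P i) \<noteq> a"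
      using vi(2)[OF PiE_mem[OF P i]] by (simp add: w_def)
    ultimately show "(\<lambda>j\<in>{1..m}. w j (P j)) \<in> {x \<in> S. x i \<noteq> a \<and> x(i := a) \<in> S}"
      using \<open>(\<lambda>j\<in>{1..m}. w j (P j)) \<in> S\<close> i by simp
  qed
  then show ?thesis by blast
qed

section \<open>Adjacency as an update of one coordinate, and the derived sets described by
  it\<close>

lemma adjacent_upd:
  assumes "i \<in> {1..m}" "u i \<noteq> b"
  shows "adjacent m u (u(i := b))" "adjacent m (u(i := b)) u"
  using assms unfolding adjacent_def by (auto intro!: ex1I[of _ i] split: if_splits)

text \<open>The unique coordinate of disagreement must be \<open>i\<close>; outside
  \<open>{1..m}\<close> both tuples agree by extensionality.\<close>

lemma adjacent_imp_upd:
  assumes "adjacent m u v" "u \<in> product m U" "v \<in> product m U" "i \<in> {1..m}" "u i \<noteq> v i"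
  shows "v = u(i := v i)"
proof
  fix j
  show "v j = (u(i := v i)) j"
  proof (cases "j \<in> {1..m}")
    case True
    then show ?thesis using assms(1,4,5) unfolding adjacent_def by (metis fun_upd_apply)
  next
    case False
    then show ?thesis using assms(2-4) by (auto simp: PiE_iff extensional_def)
  qed
qed

lemma sector_boundary_eq:
  assumes "S \<subseteq> product m U" "i \<in> {1..m}"
  shows "sector_boundary m S i a = {u \<in> S. u i = a \<and> (\<exists>b. b \<noteq> a \<and> u(i := b) \<in> S)}"
proof (intro set_eqI iffI)
  fix u assume "u \<in> sector_boundary m S i a"
  then obtain v where "u \<in> S" "u i = a" "v \<in> S" "v i \<noteq> a" "adjacent m u v"
    unfolding sector_boundary_def sector_def by blast
  moreover from this have "v = u(i := v i)"
    using assms by (intro adjacent_imp_upd[of m u v U]) auto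
  ultimately show "u \<in> {u \<in> S. u i = a \<and> (\<exists>b. b \<noteq> a \<and> u(i := b) \<in> S)}" by auto
next
  fix u assume "u \<in> {u \<in> S. u i = a \<and> (\<exists>b. b \<noteq> a \<and> u(i := b) \<in> S)}"
  then obtain b where "u \<in> S" "u i = a" "b \<noteq> a" "u(i := b) \<in> S" by blast
  then show "u \<in> sector_boundary m S i a"
    unfolding sector_boundary_def sector_def
    using adjacent_upd(1)[OF assms(2), of u b] by (auto intro: bexI[of _ "u(i := b)"])
qed

lemma neighborhood_eq:
  assumes "S \<subseteq> product m U" "i \<in> {1..m}"
  shows "neighborhood m S i a = {v \<in> S. v i \<noteq> a \<and> v(i := a) \<in> S}"
proof (intro set_eqI iffI)
  fix v assume "v \<in> neighborhood m S i a"
  then obtain u where u: "u \<in> S" "u i = a" "v \<in> S" "v i \<noteq> a" "adjacent m u v"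
    unfolding neighborhood_def cosector_def sector_def by blast
  then have "v = u(i := v i)"
    using assms by (intro adjacent_imp_upd[of m u v U]) auto
  then have "v(i := a) = u" using u(2) by (metis fun_upd_triv fun_upd_upd)
  with u show "v \<in> {v \<in> S. v i \<noteq> a \<and> v(i := a) \<in> S}" by simp
next
  fix v assume "v \<in> {v \<in> S. v i \<noteq> a \<and> v(i := a) \<in> S}"
  then show "v \<in> neighborhood m S i a"
    unfolding neighborhood_def cosector_def sector_def
    using adjacent_upd(2)[OF assms(2), of v a] by force
qed

text \<open>One condition covers both pieces, because the update \<open>v(i := a)\<close> fixes the
  points of the sector.\<close>

lemma extended_sector_eq:
  assumes "S \<subseteq> product m U" "i \<in> {1..m}"
  shows "extended_sector m S i a = {v \<in> S. v(i := a) \<in> S}"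
  unfolding extended_sector_def neighborhood_eq[OF assms] sector_def by auto

lemma carrier_eq:
  assumes "S \<subseteq> product m U" "i \<in> {1..m}"
  shows "carrier m U S i = {u \<in> S. \<exists>b. b \<noteq> u i \<and> u(i := b) \<in> S}"
proof -
  have "u i \<in> U i" if "u \<in> S" for u
    using assms that by (auto simp: PiE_iff)
  then show ?thesis
    unfolding carrier_def sector_boundary_eq[OF assms] by blast
qed

section \<open>Ampleness of the derived sets for a fixed coordinate \<open>i\<close>\<close>

context
  fixes m :: nat and U :: "nat \<Rightarrow> 'a set" and i :: nat
  assumes nonempty: "\<And>j. j \<in> {1..m} \<Longrightarrow> U j \<noteq> {}" and i: "i \<in> {1..m}"
begin

lemma partition_on_factor:
  assumes "generalized_partition m U \<Lambda>"
  shows "partition_on (U i) (\<Lambda> i)"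
  using assms i by (simp add: generalized_partition_def)

text \<open>Take any copy of \<open>\<Lambda>\<close> in \<open>S\<close>. If it avoids
  \<open>a\<close> in coordinate \<open>i\<close>, it already serves. If it uses \<open>a\<close>,
  its points with \<open>i\<close>-th coordinate \<open>a\<close> supply \<open>H1\<close> of
  \<open>ample_split\<close>, while \<open>H2\<close> is the shattering hypothesis.\<close>

lemma ample_delete_point:
  assumes ample: "ample m U S" and a: "a \<in> U i"
  shows "ample m U {u \<in> S. u i \<noteq> a}"
proof (rule ampleI)
  show "{u \<in> S. u i \<noteq> a} \<subseteq> product m U" using ample by (auto simp: ample_def)
  fix \<Lambda> assume part: "generalized_partition m U \<Lambda>"
    and sh: "\<And>P. P \<in> product m \<Lambda> \<Longrightarrow> \<exists>u\<in>{u \<in> S. u i \<noteq> a}. \<forall>j\<in>{1..m}. u j \<in> P j"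
  obtain w where w: "selects_copy m \<Lambda> S w"
    using ampleD[OF ample part] sh by blast
  show "\<exists>w. selects_copy m \<Lambda> {u \<in> S. u i \<noteq> a} w"
  proof (cases "\<exists>B\<in>\<Lambda> i. w i B = a")
    case False
    then have "selects_copy m \<Lambda> {u \<in> S. u i \<noteq> a} w"
      using selects_copyD[OF w] i by (intro selects_copyI) (auto simp: PiE_iff)
    then show ?thesis by blast
  next
    case True
    then obtain B where B: "B \<in> \<Lambda> i" "w i B = a" by blast
    \<comment> \<open>The witness is the copy point of \<open>P\<close> with its \<open>i\<close>-th
      block exchanged for the block \<open>B\<close> in which \<open>a\<close> was chosen.\<close>
    have H1: "\<exists>u\<in>S. u i = a \<and> (\<forall>j\<in>{1..m}-{i}. u j \<in> P j)" if P: "P \<in> product m \<Lambda>" for P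
    proof (intro bexI[of _ "(\<lambda>j\<in>{1..m}. w j (P j))(i := a)"])
      show "(\<lambda>j\<in>{1..m}. w j (P j))(i := a) \<in> S"
        using selects_copyD(2)[OF w, of "P(i := B)"] product_upd[OF P i B(1)]
          pick_upd[of i m w B a P, OF i B(2)] by simp
    qed (use selects_copyD(1)[OF w] P in \<open>auto simp: PiE_iff\<close>)
    have H2: "\<exists>u\<in>S. u i \<noteq> a \<and> (\<forall>j\<in>{1..m}. u j \<in> P j)" if "P \<in> product m \<Lambda>" for P
      using sh[OF that] by blast
    obtain v where "selects_copy m \<Lambda> {x \<in> S. x i \<noteq> a \<and> x(i := a) \<in> S} v"
      using ample_split[OF nonempty ample part i a H1 H2] by blast
    then have "selects_copy m \<Lambda> {u \<in> S. u i \<noteq> a} v"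
      by (rule selects_copy_mono) blast
    then show ?thesis by blast
  qed
qed

lemma ample_delete_points:
  assumes "ample m U S" "finite F" "F \<subseteq> U i"
  shows "ample m U {u \<in> S. u i \<notin> F}"
  using assms(2,3)
proof (induction F rule: finite_induct)
  case empty
  then show ?case using assms(1) by simp
next
  case (insert a F)
  then have "ample m U {u \<in> {u \<in> S. u i \<notin> F}. u i \<noteq> a}"
    by (intro ample_delete_point) auto
  moreover have "{u \<in> {u \<in> S. u i \<notin> F}. u i \<noteq> a} = {u \<in> S. u i \<notin> insert a F}" by auto
  ultimately show ?case by simp
qed

lemma ample_cosector:
  assumes "ample m U S" "a \<in> U i"
  shows "ample m U (cosector S i a)"
proof -
  have "cosector S i a = {u \<in> S. u i \<noteq> a}" by (auto simp: cosector_def sector_def)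
  with ample_delete_point[OF assms] show ?thesis by simp
qed

lemma ample_sector:
  assumes "ample m U S" "finite (U i)"
  shows "ample m U (sector S i a)"
proof -
  have "S \<subseteq> product m U" using assms(1) by (simp add: ample_def)
  then have "sector S i a = {u \<in> S. u i \<notin> U i - {a}}"
    using i by (auto simp: sector_def PiE_iff)
  with ample_delete_points[OF assms(1), of "U i - {a}"] assms(2) show ?thesis by simp
qed

text \<open>All points of the boundary have \<open>i\<close>-th coordinate \<open>a\<close>, so
  shattering forces \<open>a\<close> into every block of \<open>\<Lambda> i\<close>, which is then
  the one-block partition. The copy from \<open>ample_split\<close> lies in the neighborhood; moving
  it to \<open>a\<close> puts it into the boundary.\<close>

lemma ample_sector_boundary:
  assumes ample: "ample m U S" and a: "a \<in> U i"
  shows "ample m U (sector_boundary m S i a)"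
proof -
  have sub: "S \<subseteq> product m U" using ample by (simp add: ample_def)
  let ?T = "{u \<in> S. u i = a \<and> (\<exists>b. b \<noteq> a \<and> u(i := b) \<in> S)}"
  have "ample m U ?T"
  proof (rule ampleI)
    show "?T \<subseteq> product m U" using sub by blast
    fix \<Lambda> assume part: "generalized_partition m U \<Lambda>"
      and sh: "\<And>P. P \<in> product m \<Lambda> \<Longrightarrow> \<exists>u\<in>?T. \<forall>j\<in>{1..m}. u j \<in> P j"
    note block = partition_on_factor[OF part]
    have aB: "a \<in> B" if "B \<in> \<Lambda> i" for B
      using product_blocks_through[OF part nonempty i that] sh i by (smt (verit) mem_Collect_eq)
    have full: "B = U i" if "B \<in> \<Lambda> i" for B
    proof -
      have "C = B" if "C \<in> \<Lambda> i" for C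
        using partition_on_block_unique[OF block that \<open>B \<in> \<Lambda> i\<close>] aB that \<open>B \<in> \<Lambda> i\<close> by blast
      then have "\<Lambda> i = {B}" using that by blast
      then show ?thesis using partition_onD1[OF block] by simp
    qed
    \<comment> \<open>The neighbor \<open>u(i := b)\<close> of a boundary point stays in the same
      box, because \<open>P i\<close> is all of \<open>U i\<close>.\<close>
    have H2: "\<exists>u\<in>S. u i \<noteq> a \<and> (\<forall>j\<in>{1..m}. u j \<in> P j)" if P: "P \<in> product m \<Lambda>" for P
    proof -
      obtain u b where u: "u(i := b) \<in> S" "b \<noteq> a" "\<And>j. j \<in> {1..m} \<Longrightarrow> u j \<in> P j"
        using sh[OF P] by blast
      have "P i = U i" using full PiE_mem[OF P i] by blast
      moreover have "(u(i := b)) i \<in> U i" using u(1) sub i by blast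
      ultimately have "b \<in> P i" by simp
      then show ?thesis using u by (intro bexI[of _ "u(i := b)"]) auto
    qed
    have H1: "\<exists>u\<in>S. u i = a \<and> (\<forall>j\<in>{1..m}-{i}. u j \<in> P j)" if "P \<in> product m \<Lambda>" for P
      using sh[OF that] by blast
    obtain w where w: "selects_copy m \<Lambda> {x \<in> S. x i \<noteq> a \<and> x(i := a) \<in> S} w"
      using ample_split[OF nonempty ample part i a H1 H2] by blast
    have "selects_copy m \<Lambda> ?T (w(i := \<lambda>_. a))"
    proof (rule selects_copyI)
      show "(w(i := \<lambda>_. a)) j B \<in> B" if "j \<in> {1..m}" "B \<in> \<Lambda> j" for j B
        using selects_copyD(1)[OF w that] aB that by auto
      fix P assume P: "P \<in> product m \<Lambda>"
      define x where "x = (\<lambda>j\<in>{1..m}. w j (P j))"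
      have "x \<in> S" "x i \<noteq> a" "x(i := a) \<in> S"
        using selects_copyD(2)[OF w P] by (simp_all add: x_def)
      then have "x(i := a) \<in> ?T"
        by (auto intro: exI[of _ "x i"])
      moreover have "(\<lambda>j\<in>{1..m}. (w(i := \<lambda>_. a)) j (P j)) = x(i := a)"
        using i by (auto simp: x_def fun_eq_iff)
      ultimately show "(\<lambda>j\<in>{1..m}. (w(i := \<lambda>_. a)) j (P j)) \<in> ?T" by simp
    qed
    then show "\<exists>w. selects_copy m \<Lambda> ?T w" by blast
  qed
  then show ?thesis by (simp add: sector_boundary_eq[OF sub i])
qed

text \<open>The conclusion of \<open>ample_split\<close> is already a copy in the neighborhood. A
  shattering point gives \<open>H2\<close> itself and \<open>H1\<close> through its update to
  \<open>a\<close>.\<close>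

lemma ample_neighborhood:
  assumes ample: "ample m U S" and a: "a \<in> U i"
  shows "ample m U (neighborhood m S i a)"
proof -
  have sub: "S \<subseteq> product m U" using ample by (simp add: ample_def)
  let ?T = "{v \<in> S. v i \<noteq> a \<and> v(i := a) \<in> S}"
  have "ample m U ?T"
  proof (rule ampleI)
    show "?T \<subseteq> product m U" using sub by blast
    fix \<Lambda> assume part: "generalized_partition m U \<Lambda>"
      and sh: "\<And>P. P \<in> product m \<Lambda> \<Longrightarrow> \<exists>u\<in>?T. \<forall>j\<in>{1..m}. u j \<in> P j"
    have H1: "\<exists>u\<in>S. u i = a \<and> (\<forall>j\<in>{1..m}-{i}. u j \<in> P j)" if "P \<in> product m \<Lambda>" for P
    proof -
      from sh[OF that] obtain u where "u \<in> ?T" "\<forall>j\<in>{1..m}. u j \<in> P j" by blast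
      then show ?thesis by (intro bexI[of _ "u(i := a)"]) auto
    qed
    have H2: "\<exists>u\<in>S. u i \<noteq> a \<and> (\<forall>j\<in>{1..m}. u j \<in> P j)" if "P \<in> product m \<Lambda>" for P
      using sh[OF that] by blast
    show "\<exists>w. selects_copy m \<Lambda> ?T w"
      by (rule ample_split[OF nonempty ample part i a H1 H2])
  qed
  then show ?thesis by (simp add: neighborhood_eq[OF sub i])
qed

lemma ample_extended_sector:
  assumes ample: "ample m U S" and a: "a \<in> U i" and fin: "finite (U i)"
  shows "ample m U (extended_sector m S i a)"
proof -
  have sub: "S \<subseteq> product m U" using ample by (simp add: ample_def)
  let ?T = "{v \<in> S. v(i := a) \<in> S}"
  have "ample m U ?T"
  proof (rule ampleI)
    show "?T \<subseteq> product m U" using sub by blast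
    fix \<Lambda> assume part: "generalized_partition m U \<Lambda>"
      and sh: "\<And>P. P \<in> product m \<Lambda> \<Longrightarrow> \<exists>u\<in>?T. \<forall>j\<in>{1..m}. u j \<in> P j"
    note block = partition_on_factor[OF part]
    obtain B where B: "B \<in> \<Lambda> i" "a \<in> B" using partition_onD1[OF block] a by blast
    then have "B \<subseteq> U i" using partition_onD1[OF block] by blast
    then have ample': "ample m U {u \<in> S. u i \<notin> B - {a}}"
      using ample fin by (intro ample_delete_points) (auto intro: finite_subset)
    \<comment> \<open>Boxes through \<open>B\<close> are met by the update \<open>u(i := a)\<close>,
      which lies in \<open>S\<close> by the definition of \<open>?T\<close>; in all other boxes
      \<open>u i\<close> lies outside \<open>B\<close>, so \<open>u\<close> itself survives the
      deletion.\<close>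
    have sh': "\<exists>u\<in>{u \<in> S. u i \<notin> B - {a}}. \<forall>j\<in>{1..m}. u j \<in> P j" if P: "P \<in> product m \<Lambda>" for P
    proof -
      from sh[OF P] obtain u where u: "u \<in> ?T" "\<forall>j\<in>{1..m}. u j \<in> P j" by blast
      show ?thesis
      proof (cases "P i = B")
        case True
        then show ?thesis using u B(2) by (intro bexI[of _ "u(i := a)"]) auto
      next
        case False
        then have "u i \<notin> B"
          using partition_on_block_unique[OF block _ B(1)] PiE_mem[OF P i] u(2) i by blast
        then show ?thesis using u by (intro bexI[of _ u]) auto
      qed
    qed
    obtain w where w: "selects_copy m \<Lambda> {u \<in> S. u i \<notin> B - {a}} w"
      using ampleD[OF ample' part sh'] by blast
    obtain P0 where P0: "P0 \<in> product m \<Lambda>" "P0 i = B"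
      using product_blocks_through[OF part nonempty i B(1)] by blast
    have wB: "w i B = a"
      using selects_copyD(1)[OF w i B(1)] selects_copyD(2)[OF w P0(1)] P0(2) i by auto
    \<comment> \<open>Exchanging the \<open>i\<close>-th block for \<open>B\<close> sets the
      \<open>i\<close>-th coordinate to \<open>a\<close> without leaving the copy.\<close>
    have "(\<lambda>j\<in>{1..m}. w j (P j)) \<in> ?T" if P: "P \<in> product m \<Lambda>" for P
      using selects_copyD(2)[OF w P] selects_copyD(2)[OF w, of "P(i := B)"]
        product_upd[OF P i B(1)] pick_upd[of i m w B a P, OF i wB] by simp
    then have "selects_copy m \<Lambda> ?T w"
      using selects_copyD(1)[OF w] by (intro selects_copyI)
    then show "\<exists>w. selects_copy m \<Lambda> ?T w" by blast
  qed
  then show ?thesis by (simp add: extended_sector_eq[OF sub i])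
qed

text \<open>If \<open>\<Lambda> i\<close> has at least two blocks, every copy in \<open>S\<close>
  consists of carrier points, since each point can be moved to another block within the copy. If it
  has one block, the copy has a constant \<open>i\<close>-th coordinate \<open>a\<close>, and
  \<open>ample_split\<close> for this \<open>a\<close> provides a second copy whose points have
  neighbors in \<open>S\<close>.\<close>

lemma ample_carrier:
  assumes ample: "ample m U S"
  shows "ample m U (carrier m U S i)"
proof -
  have sub: "S \<subseteq> product m U" using ample by (simp add: ample_def)
  let ?T = "{u \<in> S. \<exists>b. b \<noteq> u i \<and> u(i := b) \<in> S}"
  have "ample m U ?T"
  proof (rule ampleI)
    show "?T \<subseteq> product m U" using sub by blast
    fix \<Lambda> assume part: "generalized_partition m U \<Lambda>"
      and sh: "\<And>P. P \<in> product m \<Lambda> \<Longrightarrow> \<exists>u\<in>?T. \<forall>j\<in>{1..m}. u j \<in> P j"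
    note block = partition_on_factor[OF part]
    obtain w where w: "selects_copy m \<Lambda> S w"
      using ampleD[OF ample part] sh by blast
    show "\<exists>w. selects_copy m \<Lambda> ?T w"
    proof (cases "\<exists>B. \<Lambda> i = {B}")
      case False
      have "(\<lambda>j\<in>{1..m}. w j (P j)) \<in> ?T" if P: "P \<in> product m \<Lambda>" for P
      proof -
        have Pi: "P i \<in> \<Lambda> i" by (rule PiE_mem[OF P i])
        then obtain B where B: "B \<in> \<Lambda> i" "B \<noteq> P i" using False by blast
        then have "w i B \<noteq> w i (P i)"
          using partition_on_block_unique[OF block B(1) Pi] selects_copyD(1)[OF w i] Pi by metis
        moreover have "(\<lambda>j\<in>{1..m}. w j (P j))(i := w i B) \<in> S"
          using selects_copyD(2)[OF w, of "P(i := B)"] product_upd[OF P i B(1)]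
            pick_upd[of i m w B _ P, OF i refl] by simp
        ultimately show ?thesis using selects_copyD(2)[OF w P] i by auto
      qed
      then have "selects_copy m \<Lambda> ?T w"
        using selects_copyD(1)[OF w] by (intro selects_copyI)
      then show ?thesis by blast
    next
      case True
      then obtain B where B: "\<Lambda> i = {B}" by blast
      then have BU: "B = U i" using partition_onD1[OF block] by simp
      define a where "a = w i B"
      have a: "a \<in> U i" using selects_copyD(1)[OF w i, of B] B BU by (simp add: a_def)
      have PB: "P i = B" if "P \<in> product m \<Lambda>" for P using PiE_mem[OF that i] B by simp
      have H1: "\<exists>u\<in>S. u i = a \<and> (\<forall>j\<in>{1..m}-{i}. u j \<in> P j)" if P: "P \<in> product m \<Lambda>" for P
        using selects_copyD(1)[OF w] selects_copyD(2)[OF w P] PB[OF P] PiE_mem[OF P] i a_def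
        by (intro bexI[of _ "\<lambda>j\<in>{1..m}. w j (P j)"]) auto
      \<comment> \<open>A carrier point \<open>u\<close> and its neighbor \<open>u(i := b)\<close>
        lie in the same box, as \<open>P i = U i\<close>, and at most one of them has
        \<open>i\<close>-th coordinate \<open>a\<close>.\<close>
      have H2: "\<exists>u\<in>S. u i \<noteq> a \<and> (\<forall>j\<in>{1..m}. u j \<in> P j)" if P: "P \<in> product m \<Lambda>" for P
      proof -
        obtain u b where u: "u \<in> S" "\<forall>j\<in>{1..m}. u j \<in> P j" "b \<noteq> u i" "u(i := b) \<in> S"
          using sh[OF P] by blast
        have "(u(i := b)) i \<in> U i" using u(4) sub i by blast
        then have "b \<in> P i" using PB[OF P] BU by simp
        then show ?thesis
          using u by (cases "u i = a") (auto intro: bexI[of _ u] bexI[of _ "u(i := b)"])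
      qed
      obtain v where "selects_copy m \<Lambda> {x \<in> S. x i \<noteq> a \<and> x(i := a) \<in> S} v"
        using ample_split[OF nonempty ample part i a H1 H2] by blast
      then have "selects_copy m \<Lambda> ?T v"
        by (rule selects_copy_mono) (auto intro!: exI[of _ a])
      then show ?thesis by blast
    qed
  qed
  then show ?thesis by (simp add: carrier_eq[OF sub i])
qed

end

theorem theorem13:
  fixes m :: nat and U :: "nat \<Rightarrow> 'a set" and S :: "(nat \<Rightarrow> 'a) set" and i :: nat
  assumes "\<And>j. j \<in> {1..m} \<Longrightarrow> finite (U j) \<and> U j \<noteq> {}"
    and "S \<subseteq> product m U"
    and "ample m U S"
    and "i \<in> {1..m}"
  shows "(\<forall>a\<in>U i. ample m U (sector S i a) \<and> ample m U (cosector S i a)) \<and>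
         (\<forall>a\<in>U i. ample m U (sector_boundary m S i a)) \<and>
         (\<forall>a\<in>U i. ample m U (neighborhood m S i a)) \<and>
         (\<forall>a\<in>U i. ample m U (extended_sector m S i a)) \<and>
         ample m U (carrier m U S i)"
proof -
  have nonempty: "\<And>j. j \<in> {1..m} \<Longrightarrow> U j \<noteq> {}" and fin: "finite (U i)"
    using assms(1,4) by auto
  note ctx = nonempty assms(4) assms(3)
  show ?thesis
    using ample_sector[OF ctx fin] ample_cosector[OF ctx] ample_sector_boundary[OF ctx]
      ample_neighborhood[OF ctx] ample_extended_sector[OF ctx _ fin] ample_carrier[OF ctx]
    by blast
qed

end
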